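(* Let $q$ be a prime power and $t\ge 2$. Assume there is a vector space partition of $V(2t,q)$ of type $(m_t,\ldots,m_1)$ with $m_t=q^t+1-a$. Let $1\le d<t$ be such that $m_d>0$. If \[ m_d<\frac{q^t-1}{q^{t-d}-1}, \] then $a\ge m_d-\mathrm{R}_q(t,d,m_d)$, where \[ \mathrm{R}_q(t,d,m):=m(m-1)\,\frac{\tfrac12(q^{2t-2d}-1)+1-q^{t-d}}{q^t-1-m(q^{t-d}-1)}. \]
   Context: A vector space partition of $V(n,q)$ (the $n$-dimensional vector space over $\mathrm{GF}(q)$) is a collection of subspaces, all of positive dimension, such that every nonzero vector lies in exactly one member. It has type $(m_t,\ldots,m_1)$ if it contains exactly $m_d$ subspaces of dimension $d$ for each $d\in\{1,\ldots,t\}$ and none of dimension larger than $t$. *)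

theory Defs
  imports "HOL-Analysis.Cartesian_Space"
begin

definition vector_space_partition :: "('k::field ^ 'n) set set \<Rightarrow> bool" where
  "vector_space_partition P \<longleftrightarrow>
     (\<forall>U\<in>P. vec.subspace U \<and> vec.dim U > 0) \<and>
     (\<forall>v. v \<noteq> 0 \<longrightarrow> (\<exists>!U. U \<in> P \<and> v \<in> U))"

text \<open>The type \<open>(m\<^sub>t, \<dots>, m\<^sub>1)\<close> is encoded by a function \<open>m\<close>
  of which only the values on \<open>{1..t}\<close> are relevant.\<close>

definition has_type :: "('k::field ^ 'n) set set \<Rightarrow> nat \<Rightarrow> (nat \<Rightarrow> nat) \<Rightarrow> bool" where
  "has_type P t m \<longleftrightarrow>
     (\<forall>d\<in>{1..t}. finite {U \<in> P. vec.dim U = d} \<and> card {U \<in> P. vec.dim U = d} = m d) \<and>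
     (\<forall>U\<in>P. vec.dim U \<le> t)"

text \<open>The exponents use truncated subtraction, so the formula has its intended meaning
  only for \<open>d \<le> t\<close>.\<close>

definition R :: "nat \<Rightarrow> nat \<Rightarrow> nat \<Rightarrow> nat \<Rightarrow> real" where
  "R q t d m =
     real m * (real m - 1) *
     ((1 / 2 * (real q ^ (2 * t - 2 * d) - 1) + 1 - real q ^ (t - d)) /
      (real q ^ t - 1 - real m * (real q ^ (t - d) - 1)))"

end

theory Submission
  imports Defs
begin

text \<open>
  For a nonzero linear functional \<open>f\<close>, let \<open>x\<close> and \<open>h\<close> be the numbers of members of dimension
  \<open>t\<close> and \<open>d\<close> contained in \<open>ker f\<close>. Two members of dimension \<open>t\<close> span the whole space, so
  \<open>x \<le> 1\<close>, and a Bonferroni-type estimate gives \<open>1 - x - h + x h + h (h - 1) / 2 \<ge> 0\<close>.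
  A subspace of dimension \<open>k\<close> is annihilated by \<open>q ^ (2 t - k)\<close> functionals, and distinct members
  of the partition are independent; hence the sum of this inequality over all \<open>f \<noteq> 0\<close> can be
  evaluated, and it is the asserted bound multiplied by the denominator of \<open>R\<close>.
\<close>

text \<open>Functionals are represented by coefficient vectors: \<open>f\<close> stands for
  \<open>\<lambda>u. scalar_product u f\<close>, so a functional has the type of the vectors it acts
  on.\<close>

definition annihilator :: "('k::field ^ 'n) set \<Rightarrow> ('k ^ 'n) set" where
  "annihilator S = {f. \<forall>u\<in>S. scalar_product u f = 0}"

lemma zero_in_annihilator [simp]: "0 \<in> annihilator S"
  by (simp add: annihilator_def scalar_product_def)

lemma annihilator_span:
  fixes S :: "('k::field ^ 'n::finite) set"
  shows "annihilator (vec.span S) = annihilator S"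
proof
  show "annihilator (vec.span S) \<subseteq> annihilator S"
    using vec.span_superset by (auto simp: annihilator_def)
  show "annihilator S \<subseteq> annihilator (vec.span S)"
  proof
    fix f :: "'k ^ 'n" assume f: "f \<in> annihilator S"
    have "vec.subspace {u. scalar_product u f = 0}"
      by (rule vec.subspaceI)
        (auto simp: scalar_product_def distrib_right sum.distrib mult.assoc sum_distrib_left[symmetric])
    moreover have "S \<subseteq> {u. scalar_product u f = 0}"
      using f by (auto simp: annihilator_def)
    ultimately have "vec.span S \<subseteq> {u. scalar_product u f = 0}"
      by (rule vec.span_minimal[rotated])
    then show "f \<in> annihilator (vec.span S)"
      by (auto simp: annihilator_def)
  qed
qed

lemma card_vec_vanishing_on:
  fixes I :: "'n::finite set"
  shows "card {v :: 'k::{zero,finite} ^ 'n. \<forall>i\<in>I. v $ i = 0} = CARD('k) ^ (CARD('n) - card I)"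
proof -
  have "bij_betw (\<lambda>v. restrict (vec_nth v) (- I)) {v :: 'k ^ 'n. \<forall>i\<in>I. v $ i = 0}
          (PiE (- I) (\<lambda>_. UNIV))"
  proof (rule bij_betwI[where g = "\<lambda>g. \<chi> i. if i \<in> I then 0 else g i"])
    fix g :: "'n \<Rightarrow> 'k" assume "g \<in> (PiE (- I) (\<lambda>_. UNIV))"
    then show "restrict (vec_nth (\<chi> i. if i \<in> I then 0 else g i)) (- I) = g"
      by (auto simp: fun_eq_iff PiE_def extensional_def)
  qed (auto simp: vec_eq_iff)
  then show ?thesis
    by (simp add: bij_betw_same_card card_PiE Compl_eq_Diff_UNIV card_Diff_subset)
qed

text \<open>Extend \<open>B\<close> to a basis and use its elements as the rows of a matrix
  \<open>M\<close>. The coordinates of \<open>M *v f\<close> are the values of \<open>f\<close> on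
  this basis, so the invertible map given by \<open>M\<close> turns the annihilator into the vectors
  that vanish at the coordinates belonging to \<open>B\<close>.\<close>

lemma card_annihilator_independent:
  fixes B :: "('k::{field,finite} ^ 'n::finite) set"
  assumes B: "vec.independent B"
  shows "card (annihilator B) = CARD('k) ^ (CARD('n) - card B)"
proof -
  obtain C where C: "B \<subseteq> C" "vec.independent C" "UNIV \<subseteq> vec.span C"
    using vec.maximal_independent_subset_extend[OF subset_UNIV B] by metis
  have "card C = CARD('n)"
    using vec.basis_card_eq_dim[OF subset_UNIV C(3,2)]
    by (simp add: vec.dimension_def card_cart_basis)
  then obtain e where e: "bij_betw e (UNIV :: 'n set) C"
    using finite_same_card_bij[of "UNIV :: 'n set" C] by auto
  define M :: "'k ^ 'n ^ 'n" where "M = (\<chi> i. e i)"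
  have "rows M = C"
    using e by (auto simp: rows_def row_def M_def bij_betw_def)
  \<comment> \<open>Spanning rows give a left inverse, which is two-sided because \<open>M\<close>
    is square.\<close>
  then have "invertible M"
    using C(3) matrix_left_invertible_span_rows_gen[of M]
    by (auto simp: invertible_left_inverse)
  then obtain N where N: "M ** N = mat 1" "N ** M = mat 1"
    unfolding invertible_def by blast
  define I where "I = e -` B"
  have [simp]: "(M *v f) $ i = scalar_product (e i) f" for f i
    by (simp add: M_def matrix_vector_mult_def scalar_product_def)
  have eI: "e ` I = B"
    using e C(1) by (auto simp: I_def bij_betw_def)
  have cI: "card I = card B"
    using eI e by (metis bij_betw_def card_image inj_on_subset subset_UNIV)
  have "bij_betw ((*v) M) (annihilator B) {v. \<forall>i\<in>I. v $ i = 0}"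
  proof (rule bij_betwI[where g = "(*v) N"])
    show "(*v) N \<in> {v. \<forall>i\<in>I. v $ i = 0} \<rightarrow> annihilator B"
    proof
      fix v :: "'k ^ 'n" assume v: "v \<in> {v. \<forall>i\<in>I. v $ i = 0}"
      have "scalar_product (e i) (N *v v) = v $ i" for i
      proof -
        have "M *v (N *v v) = v"
          by (simp add: matrix_vector_mul_assoc N)
        then show ?thesis
          by (metis \<open>\<And>i f. (M *v f) $ i = scalar_product (e i) f\<close>)
      qed
      then show "N *v v \<in> annihilator B"
        using v eI by (auto simp: annihilator_def)
    qed
  qed (use eI in \<open>auto simp: annihilator_def matrix_vector_mul_assoc N\<close>)
  then show ?thesis
    by (simp add: bij_betw_same_card card_vec_vanishing_on cI)
qed

lemma card_annihilator:
  fixes S :: "('k::{field,finite} ^ 'n::finite) set"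
  shows "card (annihilator S) = CARD('k) ^ (CARD('n) - vec.dim S)"
proof -
  obtain B where B: "B \<subseteq> S" "vec.independent B" "S \<subseteq> vec.span B" "card B = vec.dim S"
    using vec.basis_exists by metis
  have "vec.span S = vec.span B"
    using B by (metis vec.span_eq vec.span_superset subset_trans)
  then have "annihilator S = annihilator B"
    by (metis annihilator_span)
  then show ?thesis
    using card_annihilator_independent[OF B(2)] B(4) by simp
qed

text \<open>The sum of \<open>U\<close> and \<open>W\<close> is direct, so
  \<open>U \<union> W\<close> has dimension \<open>vec.dim U + vec.dim W\<close>; annihilating both
  means annihilating the union.\<close>

lemma card_annihilator_Int:
  fixes U W :: "('k::{field,finite} ^ 'n::finite) set"
  assumes "vec.subspace U" "vec.subspace W" "U \<inter> W = {0}"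
  shows "card (annihilator U \<inter> annihilator W) = CARD('k) ^ (CARD('n) - (vec.dim U + vec.dim W))"
proof -
  have span: "vec.span U = U" "vec.span W = W"
    using assms(1,2) by simp_all
  have "vec.dim (U \<union> W) = vec.dim (vec.span (U \<union> W))"
    by simp
  also have "\<dots> = vec.dim {x + y |x y. x \<in> U \<and> y \<in> W}"
    unfolding vec.span_Un span ..
  also have "\<dots> = vec.dim U + vec.dim W"
    using vec.dim_sums_Int[OF assms(1,2)] assms(3) by simp
  finally have "vec.dim (U \<union> W) = vec.dim U + vec.dim W" .
  moreover have "annihilator U \<inter> annihilator W = annihilator (U \<union> W)"
    by (auto simp: annihilator_def)
  ultimately show ?thesis
    by (simp add: card_annihilator)
qed

lemma vector_space_partition_subspace:
  "vector_space_partition P \<Longrightarrow> U \<in> P \<Longrightarrow> vec.subspace U"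
  by (simp add: vector_space_partition_def)

lemma vector_space_partition_Int:
  assumes "vector_space_partition P" "U \<in> P" "W \<in> P" "U \<noteq> W"
  shows "U \<inter> W = {0}"
proof -
  have "0 \<in> U" "0 \<in> W"
    using assms by (auto intro: vec.subspace_0 vector_space_partition_subspace)
  moreover have "v = 0" if "v \<in> U" "v \<in> W" for v
    using assms that unfolding vector_space_partition_def by metis
  ultimately show ?thesis
    by auto
qed

text \<open>For \<open>x = 0\<close> the expression is \<open>(h - 1) * (h - 2) / 2\<close>, and no
  integer lies strictly between 1 and 2; for \<open>x = 1\<close> it is
  \<open>h * (h - 1) / 2\<close>.\<close>

lemma bonferroni_pointwise:
  fixes x h :: nat
  assumes "x \<le> 1"
  shows "1 - real x - real h + real x * real h + (real h * real h - real h) / 2 \<ge> 0"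
proof (cases "x = 0")
  case True
  have "(real h - 1) * (real h - 2) \<ge> 0"
    by (cases "h \<le> 1") (auto simp: mult_nonpos_nonpos)
  then show ?thesis
    using True by (simp add: field_simps)
next
  case False
  then have "x = 1" using assms by simp
  moreover have "real h * real h \<ge> real h"
    by (cases h) auto
  ultimately show ?thesis by simp
qed

lemma real_card_eq_sum_of_bool:
  "finite Z \<Longrightarrow> real (card {z\<in>Z. Q z}) = (\<Sum>z\<in>Z. of_bool (Q z))"
  by (simp add: Int_def)

text \<open>Both sides count the triples \<open>(U, W, f)\<close> with \<open>f\<close> in
  \<open>A U\<close> and in \<open>B W\<close>. This yields all the first and second moments of
  \<open>x\<close> and \<open>h\<close> needed below.\<close>

lemma sum_card_prod_double_count:
  fixes A :: "'a \<Rightarrow> 'c set" and B :: "'b \<Rightarrow> 'c set"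
  assumes "finite X" "finite Y" "finite F"
  shows "(\<Sum>f\<in>F. real (card {U\<in>X. f \<in> A U}) * real (card {W\<in>Y. f \<in> B W}))
       = (\<Sum>U\<in>X. \<Sum>W\<in>Y. real (card (A U \<inter> B W \<inter> F)))"
proof -
  have "(\<Sum>f\<in>F. real (card {U\<in>X. f \<in> A U}) * real (card {W\<in>Y. f \<in> B W}))
      = (\<Sum>f\<in>F. \<Sum>U\<in>X. \<Sum>W\<in>Y. of_bool (f \<in> A U \<and> f \<in> B W))"
    using assms by (simp only: real_card_eq_sum_of_bool sum_product of_bool_conj)
  also have "\<dots> = (\<Sum>U\<in>X. \<Sum>f\<in>F. \<Sum>W\<in>Y. of_bool (f \<in> A U \<and> f \<in> B W))"
    by (rule sum.swap)
  also have "\<dots> = (\<Sum>U\<in>X. \<Sum>W\<in>Y. \<Sum>f\<in>F. of_bool (f \<in> A U \<and> f \<in> B W))"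
    by (intro sum.cong refl sum.swap)
  also have "\<dots> = (\<Sum>U\<in>X. \<Sum>W\<in>Y. real (card (A U \<inter> B W \<inter> F)))"
  proof (intro sum.cong refl)
    fix U W
    have "A U \<inter> B W \<inter> F = {f\<in>F. f \<in> A U \<and> f \<in> B W}" by auto
    then show "(\<Sum>f\<in>F. of_bool (f \<in> A U \<and> f \<in> B W)) = real (card (A U \<inter> B W \<inter> F))"
      using assms by (simp add: Int_def)
  qed
  finally show ?thesis .
qed

theorem theorem11:
  fixes P :: "('k::{field,finite} ^ 'n::finite) set set"
    and q t d :: nat and m :: "nat \<Rightarrow> nat" and a :: int
  assumes "q = CARD('k)"
    and "t \<ge> 2"
    and "CARD('n) = 2 * t"
    and "vector_space_partition P"
    and "has_type P t m"
    and "int (m t) = int q ^ t + 1 - a"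
    and "1 \<le> d" and "d < t"
    and "m d > 0"
    and "real (m d) < (real q ^ t - 1) / (real q ^ (t - d) - 1)"
  shows "real_of_int a \<ge> real (m d) - R q t d (m d)"
proof -
  define X where "X = {U \<in> P. vec.dim U = t}"
  define Y where "Y = {U \<in> P. vec.dim U = d}"
  define F :: "('k ^ 'n) set" where "F = - {0}"
  define x where "x f = card {U\<in>X. f \<in> annihilator U}" for f
  define h where "h f = card {W\<in>Y. f \<in> annihilator W}" for f
  have cX: "card X = m t" and cY: "card Y = m d"
    using assms(2,5,7,8) by (auto simp: has_type_def X_def Y_def)
  have fin: "finite X" "finite Y" "finite F" by auto
  have q2: "real q \<ge> 2"
  proof -
    have "card {0, 1 :: 'k} \<le> CARD('k)" by (rule card_mono) auto
    then show ?thesis using assms(1) by simp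
  qed
  have ann0: "real (card (annihilator U \<inter> F)) = real q ^ (2 * t - vec.dim U) - 1"
    for U :: "('k ^ 'n) set"
  proof -
    have "annihilator U \<inter> F = annihilator U - {0}" by (auto simp: F_def)
    then show ?thesis
      using q2 assms(1,3) by (simp add: card_annihilator)
  qed
  have ann2: "real (card (annihilator U \<inter> annihilator W \<inter> F))
      = real q ^ (2 * t - (vec.dim U + vec.dim W)) - 1"
    if "U \<in> P" "W \<in> P" "U \<noteq> W" for U W
  proof -
    have "annihilator U \<inter> annihilator W \<inter> F = (annihilator U \<inter> annihilator W) - {0}"
      by (auto simp: F_def)
    moreover have "card (annihilator U \<inter> annihilator W)
        = q ^ (2 * t - (vec.dim U + vec.dim W))"
      using that assms(1,3,4)
      by (simp add: card_annihilator_Int vector_space_partition_Int[of P]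
          vector_space_partition_subspace[of P])
    ultimately show ?thesis
      using q2 by simp
  qed
  have x_le: "x f \<le> 1" if "f \<in> F" for f
  proof (rule ccontr)
    assume "\<not> x f \<le> 1"
    then obtain U W where UW: "U \<in> X" "W \<in> X" "U \<noteq> W" "f \<in> annihilator U" "f \<in> annihilator W"
      unfolding x_def by (smt (verit) card_le_Suc0_iff_eq finite mem_Collect_eq One_nat_def)
    \<comment> \<open>The exponent in \<open>ann2\<close> is \<open>2 * t - (t + t) = 0\<close>, so
      only the zero functional annihilates both members.\<close>
    then have "card (annihilator U \<inter> annihilator W \<inter> F) = 0"
      using ann2[of U W] by (simp add: X_def)
    then show False
      using UW that by auto
  qed
  \<comment> \<open>All sums become polynomials in \<open>T\<close>, \<open>Q\<close>,
    \<open>M\<close> and \<open>m t\<close>; \<open>D\<close> is the denominator of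
    \<open>R\<close>.\<close>
  define Q where "Q = real q ^ (t - d)"
  define T where "T = real q ^ t"
  define M where "M = real (m d)"
  define D where "D = T - 1 - M * (Q - 1)"
  \<comment> \<open>The index set \<open>{()}\<close> with the constant family \<open>UNIV\<close>
    makes the second factor 1, so the double count gives a first moment.\<close>
  have sx: "(\<Sum>f\<in>F. real (x f)) = real (m t) * (T - 1)"
    using sum_card_prod_double_count[OF fin(1) _ fin(3), of "{()}" annihilator "\<lambda>_. UNIV"]
    by (simp add: x_def ann0 X_def T_def flip: cX)
  have TQ: "real q ^ (2 * t - d) = T * Q"
    using assms(8) by (simp add: T_def Q_def mult_2 flip: power_add)
  have QQ: "real q ^ (2 * t - 2 * d) = Q\<^sup>2"
    by (simp add: Q_def diff_mult_distrib mult.commute flip: power_mult)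
  have sh: "(\<Sum>f\<in>F. real (h f)) = M * (T * Q - 1)"
    using sum_card_prod_double_count[OF fin(2) _ fin(3), of "{()}" annihilator "\<lambda>_. UNIV"]
    by (simp add: h_def ann0 Y_def M_def TQ flip: cY)
  have sxh: "(\<Sum>f\<in>F. real (x f) * real (h f)) = real (m t) * M * (Q - 1)"
  proof -
    have "(\<Sum>f\<in>F. real (x f) * real (h f)) = (\<Sum>U\<in>X. \<Sum>W\<in>Y. Q - 1)"
      unfolding x_def h_def sum_card_prod_double_count[OF fin]
    proof (intro sum.cong refl)
      fix U W assume "U \<in> X" "W \<in> Y"
      \<comment> \<open>Since \<open>d < t\<close>, the members \<open>U\<close> and
        \<open>W\<close> are distinct and \<open>ann2\<close> applies.\<close>
      then show "real (card (annihilator U \<inter> annihilator W \<inter> F)) = Q - 1"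
        using ann2[of U W] assms(8) by (auto simp: X_def Y_def Q_def)
    qed
    then show ?thesis by (simp add: cX cY M_def)
  qed
  have shh: "(\<Sum>f\<in>F. real (h f) * real (h f)) = M * ((M - 1) * (Q\<^sup>2 - 1) + (T * Q - 1))"
  proof -
    have "(\<Sum>f\<in>F. real (h f) * real (h f)) = (\<Sum>U\<in>Y. (M - 1) * (Q\<^sup>2 - 1) + (T * Q - 1))"
      unfolding h_def sum_card_prod_double_count[OF fin(2,2,3)]
    proof (intro sum.cong refl)
      fix U assume U: "U \<in> Y"
      \<comment> \<open>For each \<open>U\<close>, the diagonal pair \<open>W = U\<close> is split
        off: it contributes \<open>T * Q - 1\<close>, every other \<open>W\<close> contributes
        \<open>Q\<^sup>2 - 1\<close>.\<close>
      have "real (card (annihilator U \<inter> annihilator W \<inter> F)) = Q\<^sup>2 - 1" if "W \<in> Y - {U}" for W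
        using ann2[of U W] U that by (simp add: Y_def QQ eq_commute[of U] flip: mult_2)
      moreover have "real (card (annihilator U \<inter> annihilator U \<inter> F)) = T * Q - 1"
        using U by (simp add: ann0 Y_def TQ)
      ultimately have "(\<Sum>W\<in>Y. real (card (annihilator U \<inter> annihilator W \<inter> F)))
          = (T * Q - 1) + real (card (Y - {U})) * (Q\<^sup>2 - 1)"
        by (simp add: sum.remove[OF fin(2) U])
      moreover have "real (card (Y - {U})) = M - 1"
        using U cY assms(9) by (simp add: M_def)
      ultimately show "(\<Sum>W\<in>Y. real (card (annihilator U \<inter> annihilator W \<inter> F)))
          = (M - 1) * (Q\<^sup>2 - 1) + (T * Q - 1)"
        by simp
    qed
    then show ?thesis by (simp add: cY M_def)
  qed
  \<comment> \<open>Every functional annihilates the empty set, whose dimension is 0.\<close>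
  have cF: "real (card F) = T\<^sup>2 - 1"
    using ann0[of "{}"] by (simp add: annihilator_def T_def mult.commute flip: power_mult)
  have "0 \<le> (\<Sum>f\<in>F. 1 - real (x f) - real (h f) + real (x f) * real (h f)
      + (real (h f) * real (h f) - real (h f)) / 2)"
    by (intro sum_nonneg bonferroni_pointwise x_le)
  also have "\<dots> = (T\<^sup>2 - 1) - real (m t) * (T - 1) - M * (T * Q - 1) + real (m t) * M * (Q - 1)
      + (M * ((M - 1) * (Q\<^sup>2 - 1) + (T * Q - 1)) - M * (T * Q - 1)) / 2"
    by (simp add: sum.distrib sum_subtractf sx sh sxh shh cF flip: sum_divide_distrib)
  \<comment> \<open>The diagonal part of \<open>shh\<close> cancels against \<open>sh\<close>,
    leaving half the contribution of the ordered pairs of distinct members of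
    \<open>Y\<close>.\<close>
  finally have main: "0 \<le> (T\<^sup>2 - 1) - real (m t) * (T - 1) - M * (T * Q - 1)
      + real (m t) * M * (Q - 1) + M * (M - 1) * (Q\<^sup>2 - 1) / 2"
    by (simp add: algebra_simps)
  have mt: "real (m t) = T + 1 - real_of_int a"
    using arg_cong[OF assms(6), of real_of_int] by (simp add: T_def)
  have Q1: "Q > 1"
    using q2 assms(8) by (simp add: Q_def)
  \<comment> \<open>Multiplied by \<open>Q - 1 > 0\<close>, the strict upper bound on
    \<open>m d\<close> says exactly this.\<close>
  have D: "D > 0"
    using assms(10) Q1 by (simp add: D_def M_def Q_def T_def pos_less_divide_eq)
  \<comment> \<open>After substituting \<open>m t = T + 1 - a\<close>, the terms with
    \<open>a\<close> collect to \<open>a * D\<close>. Those that remain besides the last one of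
    \<open>main\<close> are \<open>M * (Q - T) = - M * D - M * (M - 1) * (Q - 1)\<close>.\<close>
  have "M * (M - 1) * (1 / 2 * (Q\<^sup>2 - 1) + 1 - Q) \<ge> (M - real_of_int a) * D"
    using main unfolding mt D_def by (simp add: field_simps power2_eq_square)
  then have "M - real_of_int a \<le> M * (M - 1) * ((1 / 2 * (Q\<^sup>2 - 1) + 1 - Q) / D)"
    using D by (simp add: pos_le_divide_eq)
  then show ?thesis
    unfolding R_def QQ by (simp add: M_def D_def Q_def T_def)
qed

end
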